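(* Let $m\ge 1$ be an integer and let $J,J',K,K'\subseteq\{0,1,\ldots,m-1\}$ be nonempty with $|J|=|J'|=|K|=|K'|$, and suppose that $H_{J,K}$ is a Hadamard submatrix of $\mathcal{F}_m$. If $\mathcal{P}_m(J')=\mathcal{P}_m(J)$ and $\mathcal{P}_m(K')=\mathcal{P}_m(K)$, then $H_{J',K'}$ is also a Hadamard submatrix of $\mathcal{F}_m$. Alternatively, if $\mathcal{P}_m(J')=\mathcal{P}_m(K)$ and $\mathcal{P}_m(K')=\mathcal{P}_m(J)$, then $H_{J',K'}$ is also a Hadamard submatrix of $\mathcal{F}_m$.
   Context: $\mathcal{F}_m=(e^{2\pi i jk/m})_{0\le j,k\le m-1}$ is the $m\times m$ Fourier matrix. For $J,K\subseteq\{0,\ldots,m-1\}$ with $|J|=|K|=n$, $H_{J,K}=H_{J,K,m}=(e^{2\pi i jk/m})_{j\in J,k\in K}$ is the $n\times n$ submatrix of $\mathcal{F}_m$ with rows $J$ and columns $K$ (each listed in increasing order). An $n\times n$ complex matrix $H$ is Hadamard if all its entries have modulus $1$ and $H^*H=HH^*=nI_n$. For a nonempty finite set $X$ of nonnegative integers, $\mathcal{D}(X)=\{x_1-x_2:x_1,x_2\in X\}$ is the difference set and $\mathcal{P}_m(X)=\left\{\frac{m}{\gcd(m,d)}:d\in\mathcal{D}(X)\right\}$ is the $m$-th primitive set of $X$ (with $\gcd(m,0)=m$). *)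

theory Defs
  imports
    Complex_Main
    "Jordan_Normal_Form.Schur_Decomposition"
    "Jordan_Normal_Form.DL_Submatrix"
begin

(* Rows and columns are indexed from 0. For J, K contained in {0..<m}, the matrix H_{J,K}
   is submatrix (fourier_mat m) J K, which lists the selected rows and columns in
   increasing order. *)

definition fourier_mat :: "nat \<Rightarrow> complex mat" where
  "fourier_mat m =
     mat m m (\<lambda>(j, k). exp (2 * complex_of_real pi * \<i> * of_nat j * of_nat k / of_nat m))"

definition hadamard_mat :: "complex mat \<Rightarrow> bool" where
  "hadamard_mat H \<longleftrightarrow>
     (let n = dim_row H in
        H \<in> carrier_mat n n \<and>
        (\<forall>i<n. \<forall>j<n. cmod (H $$ (i, j)) = 1) \<and>
        mat_adjoint H * H = of_nat n \<cdot>\<^sub>m 1\<^sub>m n \<and>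
        H * mat_adjoint H = of_nat n \<cdot>\<^sub>m 1\<^sub>m n)"

(* Differences are signed, hence integers: subtraction on nat would truncate. *)
definition difference_set :: "nat set \<Rightarrow> int set" where
  "difference_set X = {int x - int y | x y. x \<in> X \<and> y \<in> X}"

(* The division is exact. The difference 0 contributes the element 1 when m is positive. *)
definition primitive_set :: "nat \<Rightarrow> nat set \<Rightarrow> int set" where
  "primitive_set m X = {int m div gcd (int m) d | d. d \<in> difference_set X}"

end

theory Submission
  imports Defs
begin

text \<open>
Write \<open>w = exp (2 \<pi> \<i> / m)\<close> and \<open>S K d = (\<Sum>k\<in>K. w^(d k))\<close>. The inner product of the rows of the
submatrix belonging to \<open>x, y \<in> J\<close> is \<open>S K (x - y)\<close>. As the matrix is square with entries of modulus 1,
it is Hadamard if and only if \<open>S K d = 0\<close> for all nonzero differences \<open>d\<close> of \<open>J\<close>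
(\<open>hadamard_imp_rows_orthogonal\<close>, \<open>rows_orthogonal_imp_hadamard\<close>). The Fourier matrix is symmetric, so the
condition is symmetric in \<open>J\<close> and \<open>K\<close>.

The vanishing of \<open>S K d\<close> depends only on \<open>gcd m d\<close>: numbers \<open>d\<close> with the same gcd yield roots of unity
\<open>w^d\<close> of the same order, and an integer polynomial that vanishes at one of them vanishes at all
(\<open>exponential_sum_zero_same_gcd\<close>). The primitive set of \<open>J\<close> records exactly the gcds of its differences,
so the condition for \<open>(J, K)\<close> depends on \<open>J\<close> only through its primitive set. Replacing \<open>J\<close> by \<open>J'\<close>,
transposing, replacing \<open>K\<close> by \<open>K'\<close> and transposing back proves the first claim. The second one is the
first one applied to the transpose.

The conjugacy of roots of unity of equal order amounts to the irreducibility of the cyclotomic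
polynomials. The argument here (\<open>root_sum_zero_conjugate\<close>) is close to that of Landau. If a power sum \<open>f\<close>
vanishes at \<open>z\<close>, then \<open>f (z^p)\<close> is divisible by \<open>p\<close> in \<open>\<int>[z]\<close> for each prime \<open>p\<close>, by the Frobenius
congruence. The values \<open>f (z^a)\<close> are finite in number, and a nonzero element of \<open>\<int>[z]\<close> has finitely many
integer divisors (\<open>zero_if_divisible_by_unboundedly_many\<close>). Therefore \<open>f (z^p) = 0\<close> for all large
primes \<open>p\<close>. Each residue class coprime to the order of \<open>z\<close> contains a product of large primes
(\<open>coprime_residue_large_prime_factors\<close>), which settles all exponents.
\<close>

section \<open>Polynomials with integer coefficients at a root of unity\<close>

definition int_eval :: "int poly \<Rightarrow> complex \<Rightarrow> complex" where
  "int_eval g z = poly (map_poly of_int g) z"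

lemma int_eval_simps [simp]:
  "int_eval 0 z = 0"
  "int_eval (g + h) z = int_eval g z + int_eval h z"
  "int_eval (g - h) z = int_eval g z - int_eval h z"
  "int_eval (g * h) z = int_eval g z * int_eval h z"
  "int_eval (smult c g) z = of_int c * int_eval g z"
  "int_eval (monom c n) z = of_int c * z ^ n"
  "int_eval 1 z = 1"
  by (simp_all add: int_eval_def hom_distribs poly_monom)

lemma int_eval_sum [simp]: "int_eval (\<Sum>k\<in>K. f k) z = (\<Sum>k\<in>K. int_eval (f k) z)"
  by (induction K rule: infinite_finite_induct) auto

lemma int_eval_power [simp]: "int_eval (g ^ n) z = int_eval g z ^ n"
  by (induction n) auto

lemma int_eval_of_nat [simp]: "int_eval (of_nat n) z = of_nat n"
  by (induction n) auto

lemma int_eval_degree_0: "degree g = 0 \<Longrightarrow> int_eval g z = of_int (lead_coeff g)"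
  by (auto simp: int_eval_def hom_distribs elim!: degree_eq_zeroE)

text \<open>As \<open>q\<close> may fail to be monic, a value \<open>int_eval g z\<close> need not be attained below \<open>degree q\<close>.
Pseudo-division shows that a multiple of it by a power of the leading coefficient is.\<close>
lemma pseudo_reduction:
  assumes "q \<noteq> 0" "int_eval q z = 0"
  shows "\<exists>t. (t = 0 \<or> degree t < degree q) \<and>
           int_eval t z = of_int (lead_coeff q ^ (Suc (degree g) - degree q)) * int_eval g z"
proof -
  obtain s t where st: "pseudo_divmod g q = (s, t)" by force
  show ?thesis
  proof (intro exI conjI)
    show "t = 0 \<or> degree t < degree q"
      using pseudo_divmod(2)[OF assms(1) st] .
    have "int_eval (smult (lead_coeff q ^ (Suc (degree g) - degree q)) g) z = int_eval (q * s + t) z"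
      using pseudo_divmod(1)[OF assms(1) st] by simp
    then show "int_eval t z = of_int (lead_coeff q ^ (Suc (degree g) - degree q)) * int_eval g z"
      using assms(2) by simp
  qed
qed

text \<open>A nonzero element of \<open>\<int>[z]\<close> is divisible by only finitely many positive integers. Take \<open>q\<close> of
least degree among the nonzero integer polynomials vanishing at \<open>z\<close>. Below that degree a polynomial
is determined by its value at \<open>z\<close>, and a fixed power of the leading coefficient of \<open>q\<close> brings every
element of \<open>\<int>[z]\<close> below it. Divisibility of the element thus becomes divisibility of each
coefficient of one fixed polynomial.\<close>
lemma zero_if_divisible_by_unboundedly_many:
  fixes z :: complex
  assumes r: "r > 0" and z: "z ^ r = 1"
    and div: "\<And>n. \<exists>p>n. \<exists>g. int_eval f z = of_nat p * int_eval g z"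
  shows "int_eval f z = 0"
proof -
  let ?X = "monom 1 r - 1 :: int poly"
  have X: "degree ?X = r" "lead_coeff ?X = 1"
  proof -
    have "degree (monom (1::int) r + (- 1)) = degree (monom (1::int) r)"
      by (rule degree_add_eq_left) (use r in \<open>simp add: degree_monom_eq\<close>)
    then show "degree ?X = r" by (simp add: degree_monom_eq)
    then show "lead_coeff ?X = 1" using r by simp
  qed
  have X0: "?X \<noteq> 0" using X r by auto
  have Xz: "int_eval ?X z = 0" using z by simp
  define P where "P q \<longleftrightarrow> q \<noteq> 0 \<and> int_eval q z = 0" for q
  obtain q where q: "P q" and min: "\<And>t. P t \<Longrightarrow> degree q \<le> degree t"
    using ex_has_least_nat[of P ?X degree] X0 Xz unfolding P_def by blast
  let ?c = "lead_coeff q"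
  have q0: "q \<noteq> 0" "int_eval q z = 0" using q by (auto simp: P_def)
  have c0: "?c \<noteq> 0" using q0 by simp
  have dq: "degree q > 0"
  proof (rule ccontr)
    assume "\<not> degree q > 0"
    then have "int_eval q z = of_int ?c" using int_eval_degree_0[of q z] by simp
    then show False using q0 c0 by simp
  qed
  \<comment> \<open>Reduction modulo \<open>x^r - 1\<close> comes first: it bounds the degree, so that the single
      multiplier \<open>?c ^ r\<close> serves all \<open>g\<close>.\<close>
  have red: "\<exists>t. degree t < degree q \<and> int_eval t z = of_int (?c ^ r) * int_eval g z" for g
  proof -
    obtain g' where g': "g' = 0 \<or> degree g' < r" "int_eval g' z = int_eval g z"
      using pseudo_reduction[OF X0 Xz, of g] X by auto
    obtain t where t: "t = 0 \<or> degree t < degree q"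
      "int_eval t z = of_int (?c ^ (Suc (degree g') - degree q)) * int_eval g' z"
      using pseudo_reduction[OF q0] by blast
    let ?e = "Suc (degree g') - degree q"
    \<comment> \<open>The exponent from pseudo-division varies with \<open>g\<close>; padding makes it equal to \<open>r\<close>.\<close>
    let ?t = "smult (?c ^ (r - ?e)) t"
    have e: "?e \<le> r" using g'(1) r dq by auto
    have "degree ?t < degree q" using t(1) dq by auto
    moreover have "int_eval ?t z = of_int (?c ^ (r - ?e) * ?c ^ ?e) * int_eval g z"
      using t(2) g'(2) by simp
    moreover have "?c ^ (r - ?e) * ?c ^ ?e = ?c ^ r"
      using e by (simp flip: power_add)
    ultimately show ?thesis by metis
  qed
  obtain R where R: "degree R < degree q" "int_eval R z = of_int (?c ^ r) * int_eval f z"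
    using red by blast
  have "coeff R i = 0" for i
  proof -
    \<comment> \<open>A divisor exceeding the coefficient in absolute value forces it to vanish.\<close>
    obtain p g where p: "p > nat \<bar>coeff R i\<bar>" "int_eval f z = of_nat p * int_eval g z"
      using div by blast
    obtain T where T: "degree T < degree q" "int_eval T z = of_int (?c ^ r) * int_eval g z"
      using red by blast
    have "int_eval (R - smult (int p) T) z = 0"
      using R(2) T(2) p(2) by simp
    moreover have "degree (R - smult (int p) T) < degree q"
      using R(1) T(1) by (intro degree_diff_less) (auto intro: le_less_trans[OF degree_smult_le])
    ultimately have "R - smult (int p) T = 0"
      using min[of "R - smult (int p) T"] unfolding P_def by force
    then have "coeff R i = int p * coeff T i" by (metis coeff_smult eq_iff_diff_eq_0)
    then have "int p dvd coeff R i" by simp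
    moreover have "\<bar>coeff R i\<bar> < int p" using p(1) by linarith
    ultimately show ?thesis using dvd_imp_le_int[of "coeff R i" "int p"] by fastforce
  qed
  then have "R = 0" by (simp add: poly_eqI)
  then show ?thesis using R(2) c0 by simp
qed

section \<open>Conjugation of power sums of roots of unity\<close>

text \<open>The Frobenius congruence modulo \<open>p\<close>. The ring may have characteristic 0, as the integer polynomials
do to which it is applied.\<close>
lemma prime_dvd_power_sum_diff:
  fixes x :: "'b \<Rightarrow> 'a :: comm_ring_1"
  assumes p: "prime p"
  shows "of_nat p dvd (\<Sum>k\<in>K. x k) ^ p - (\<Sum>k\<in>K. x k ^ p)"
proof (induction K rule: infinite_finite_induct)
  case (insert k K)
  have two: "of_nat p dvd (a + b) ^ p - (a ^ p + b ^ p)" for a b :: 'a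
  proof -
    have p0: "p > 0" using p prime_gt_0_nat by blast
    let ?t = "\<lambda>i. of_nat (p choose i) * a ^ i * b ^ (p - i)"
    have "{..p} = insert 0 (insert p {0<..<p})" by auto
    then have "(a + b) ^ p - (a ^ p + b ^ p) = (\<Sum>i\<in>{0<..<p}. ?t i)"
      using p0 unfolding binomial_ring by simp
    also have "of_nat p dvd \<dots>"
    proof (rule dvd_sum)
      fix i assume "i \<in> {0<..<p}"
      then have "p dvd (p choose i)" using p by (intro dvd_choose_prime) auto
      then have "of_nat p dvd (of_nat (p choose i) :: 'a)" by (auto elim!: dvdE)
      then show "of_nat p dvd ?t i" by (simp add: mult.assoc)
    qed
    finally show ?thesis .
  qed
  show ?case
    using dvd_add[OF two[of "x k" "\<Sum>k\<in>K. x k"] insert.IH] insert.hyps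
    by (simp add: algebra_simps)
qed (use prime_gt_0_nat[OF p] in \<open>auto simp: power_0_left\<close>)

text \<open>If the power sum at \<open>z ^ a\<close> vanishes, so does its \<open>p\<close>-th power, which is congruent to the power sum
at the \<open>p\<close>-th powers. The congruence is taken among integer polynomials, which keeps the cofactor in
\<open>\<int>[z]\<close>.\<close>
lemma prime_dvd_root_sum_power:
  assumes p: "prime p" and zero: "(\<Sum>k\<in>K. (z ^ a) ^ k) = 0"
  shows "\<exists>g. (\<Sum>k\<in>K. (z ^ (p * a)) ^ k) = of_nat p * int_eval g z"
proof -
  let ?x = "\<lambda>k. monom 1 (a * k) :: int poly"
  obtain h where h: "(\<Sum>k\<in>K. ?x k) ^ p - (\<Sum>k\<in>K. ?x k ^ p) = of_nat p * h"
    using prime_dvd_power_sum_diff[OF p, of ?x K] by (auto elim: dvdE)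
  have "(\<Sum>k\<in>K. (z ^ a) ^ k) ^ p - (\<Sum>k\<in>K. (z ^ (p * a)) ^ k) = of_nat p * int_eval h z"
    using arg_cong[OF h, of "\<lambda>g. int_eval g z"]
    by (simp add: power_mult mult.commute[of p a] power_commutes flip: power_mult)
       (simp add: ac_simps)
  then have "(\<Sum>k\<in>K. (z ^ (p * a)) ^ k) = of_nat p * int_eval (- h) z"
    using zero p prime_gt_0_nat[of p] int_eval_simps(3)[of 0 h z]
    by (simp add: power_0_left minus_equation_iff[of _ "_ * _"])
  then show ?thesis by blast
qed

lemma power_mod_order:
  fixes z :: "'a :: monoid_mult"
  assumes "z ^ r = 1"
  shows "z ^ (a mod r) = z ^ a"
  by (metis assms div_mult_mod_eq mult.left_neutral power_add power_mult power_one mult.commute)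

text \<open>The value of the power sum at \<open>z ^ a\<close> depends only on \<open>a mod r\<close>, so it takes finitely many values,
each of them zero or divisible by finitely many primes only. Hence one bound \<open>B\<close> works for all \<open>a\<close>,
which allows multiplication by several large primes in succession.\<close>
lemma root_sum_large_prime_power:
  fixes z :: complex
  assumes r: "r > 0" and z: "z ^ r = 1"
  shows "\<exists>B. \<forall>p a. prime p \<and> p > B \<and> (\<Sum>k\<in>K. (z ^ a) ^ k) = 0
           \<longrightarrow> (\<Sum>k\<in>K. (z ^ (p * a)) ^ k) = 0"
proof -
  let ?S = "\<lambda>a. \<Sum>k\<in>K. (z ^ a) ^ k"
  have "\<exists>B. \<forall>p>B. (\<exists>g. ?S a = of_nat p * int_eval g z) \<longrightarrow> ?S a = 0" for a
  proof (rule ccontr)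
    assume contra: "\<nexists>B. \<forall>p>B. (\<exists>g. ?S a = of_nat p * int_eval g z) \<longrightarrow> ?S a = 0"
    have S: "?S a = int_eval (\<Sum>k\<in>K. monom 1 (a * k)) z" by (simp add: power_mult)
    have "int_eval (\<Sum>k\<in>K. monom 1 (a * k)) z = 0"
      by (rule zero_if_divisible_by_unboundedly_many[OF r z]) (use contra S in metis)
    then show False using contra S by auto
  qed
  then obtain B where B: "\<And>a p. p > B a \<Longrightarrow> (\<exists>g. ?S a = of_nat p * int_eval g z) \<Longrightarrow> ?S a = 0"
    by metis
  have "?S (p * a) = 0" if p: "prime p" "p > Max (B ` {..<r})" and zero: "?S a = 0" for p a
  proof -
    \<comment> \<open>The bound must be taken at the exponent \<open>p * a\<close>, where divisibility by \<open>p\<close> is known.\<close>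
    let ?b = "(p * a) mod r"
    have b: "?S (p * a) = ?S ?b" by (simp add: power_mod_order[OF z])
    have "B ?b \<le> Max (B ` {..<r})" using r by (intro Max_ge) auto
    then have "B ?b < p" using p(2) by simp
    then show ?thesis
      using B[of ?b p] prime_dvd_root_sum_power[OF p(1) zero] b by simp
  qed
  then show ?thesis by blast
qed

text \<open>The witness is \<open>a + r * \<Prod>Q\<close> with \<open>Q\<close> the set of small primes that do not divide \<open>a\<close>. Every small
prime divides exactly one of the two summands: if it divides \<open>a\<close>, it divides neither \<open>r\<close>, by
coprimality, nor \<open>\<Prod>Q\<close>.\<close>
lemma coprime_residue_large_prime_factors:
  assumes "coprime a (r :: nat)"
  shows "\<exists>b. b > 0 \<and> b mod r = a mod r \<and> (\<forall>p. prime p \<longrightarrow> p dvd b \<longrightarrow> p > B)"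
proof -
  define Q where "Q = {q. prime q \<and> q \<le> B \<and> \<not> q dvd a}"
  define b where "b = a + r * \<Prod>Q"
  have fin: "finite Q" by (rule finite_subset[of _ "{..B}"]) (auto simp: Q_def)
  have large: "p > B" if p: "prime p" "p dvd b" for p
  proof (rule ccontr)
    assume le: "\<not> p > B"
    show False
    proof (cases "p dvd a")
      case True
      then have "p dvd r * \<Prod>Q" using p(2) by (simp add: b_def dvd_add_right_iff)
      moreover have "\<not> p dvd r"
        using True assms p(1) by (meson coprime_common_divisor not_prime_unit)
      ultimately have "p dvd \<Prod>Q" using p(1) by (simp add: prime_dvd_mult_iff)
      then obtain q where "q \<in> Q" "p dvd q" using p(1) fin by (auto simp: prime_dvd_prod_iff)
      then show False using True p(1) primes_dvd_imp_eq by (auto simp: Q_def)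
    next
      case False
      then have "p \<in> Q" using p(1) le by (simp add: Q_def)
      then have "p dvd r * \<Prod>Q" using fin by (simp add: dvd_prod_eqI)
      then show False using False p(2) by (simp add: b_def dvd_add_left_iff)
    qed
  qed
  have "b > 0"
  proof (rule ccontr)
    assume "\<not> b > 0"
    then have "a = 0" "r * \<Prod>Q = 0" by (simp_all add: b_def)
    then show False using assms by (simp add: Q_def)
  qed
  moreover have "b mod r = a mod r" by (simp add: b_def)
  ultimately show ?thesis using large by blast
qed

text \<open>This is the Galois conjugacy of primitive roots of unity, in the only form that is used. The exponent
\<open>a\<close> is replaced by a congruent one with large prime factors, which are then introduced one at a time.\<close>
lemma root_sum_zero_conjugate:
  fixes z :: complex
  assumes r: "r > 0" and z: "z ^ r = 1" and a: "coprime a r"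
    and zero: "(\<Sum>k\<in>K. z ^ k) = 0"
  shows "(\<Sum>k\<in>K. (z ^ a) ^ k) = 0"
proof -
  obtain B where B: "\<And>p c. prime p \<Longrightarrow> p > B \<Longrightarrow> (\<Sum>k\<in>K. (z ^ c) ^ k) = 0 \<Longrightarrow>
      (\<Sum>k\<in>K. (z ^ (p * c)) ^ k) = 0"
    using root_sum_large_prime_power[OF r z] by blast
  obtain b where b: "b > 0" "b mod r = a mod r" "\<And>p. prime p \<Longrightarrow> p dvd b \<Longrightarrow> p > B"
    using coprime_residue_large_prime_factors[OF a] by blast
  have "(\<Sum>k\<in>K. (z ^ b) ^ k) = 0"
    using b(1,3)
  proof (induction b rule: prime_divisors_induct)
    case (factor p x)
    then show ?case by (intro B) (auto simp: prime_gt_0_nat)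
  qed (use zero in auto)
  moreover have "z ^ b = z ^ a"
    using power_mod_order[OF z, of a] power_mod_order[OF z, of b] b(2) by simp
  ultimately show ?thesis by simp
qed


section \<open>Exponential sums depend only on a greatest common divisor\<close>

definition unity_root :: "nat \<Rightarrow> int \<Rightarrow> complex" where
  "unity_root m d = cis (2 * pi * real_of_int d / real m)"

lemma unity_root_power: "unity_root m d ^ k = unity_root m (d * int k)"
  by (simp add: unity_root_def DeMoivre algebra_simps)

lemma unity_root_mult: "unity_root m c * unity_root m d = unity_root m (c + d)"
  by (simp add: unity_root_def cis_mult ring_distribs add_divide_distrib)

lemma unity_root_multiple: "m > 0 \<Longrightarrow> unity_root m (int m * c) = 1"
  using cis_multiple_2pi[of "real_of_int c"] by (simp add: unity_root_def mult.assoc)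

lemma unity_root_cnj: "cnj (unity_root m d) = unity_root m (- d)"
  by (simp add: unity_root_def cis_cnj)

lemma unity_root_cong:
  assumes "m > 0" "c mod int m = d mod int m"
  shows "unity_root m c = unity_root m d"
proof -
  obtain e where "c = d + int m * e"
    using assms(2) by (metis mod_eqE)
  then show ?thesis by (simp add: assms(1) unity_root_multiple flip: unity_root_mult)
qed

text \<open>After division by the common value \<open>g\<close> of the gcd, both \<open>c\<close> and \<open>d\<close> become units modulo
\<open>r = m / g\<close>, and \<open>a\<close> is their quotient there. The number \<open>r\<close> is a period of the root of unity with
exponent \<open>c\<close>, so coprimality to \<open>r\<close>, rather than to \<open>m\<close>, is what conjugation needs.\<close>
lemma same_gcd_imp_unit_multiple:
  fixes c d :: int
  assumes m: "m > 0" and gcd: "gcd (int m) c = gcd (int m) d"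
  shows "\<exists>a r. r > 0 \<and> coprime a r \<and> int m dvd c * int r \<and> (c * int a) mod int m = d mod int m"
proof -
  define g where "g = gcd (int m) c"
  have g: "g > 0" using m by (simp add: g_def)
  define r where "r = int m div g"
  define u where "u = c div g"
  define v where "v = d div g"
  have eq: "int m = g * r" "c = g * u" "d = g * v"
    by (simp_all add: r_def u_def v_def g_def) (simp add: gcd)
  have r: "r > 0" using eq(1) m g by (metis of_nat_0_less_iff zero_less_mult_pos)
  have "gcd r u = 1" 
    using g g_def unfolding eq(1,2) by (simp add: gcd_mult_left)
  then have cu: "coprime u r" by (simp add: coprime_iff_gcd_eq_1 gcd.commute)
  have "gcd r v = 1"
    using g g_def gcd unfolding eq(1,3) by (simp add: gcd_mult_left)
  then have cv: "coprime v r" by (simp add: coprime_iff_gcd_eq_1 gcd.commute)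
  obtain s t where st: "s * u + t * r = 1"
    using bezout_int[of u r] cu by (auto simp: coprime_iff_gcd_eq_1)
  define a where "a = nat ((v * s) mod r)"
  have a: "int a = (v * s) mod r" using r by (simp add: a_def)
  have "coprime s r"
  proof (rule coprimeI)
    fix x assume "x dvd s" "x dvd r"
    then have "x dvd s * u + t * r" by simp
    then show "is_unit x" using st by simp
  qed
  then have "coprime (v * s) r" using cv by simp
  then have "coprime (int a) r" by (metis a coprime_iff_gcd_eq_1 gcd.commute gcd_red_int)
  then have ca: "coprime a (nat r)" using r by (metis coprime_int_iff int_nat_eq order_less_imp_le)
  have "(u * int a) mod r = (v * (s * u)) mod r"
    by (simp add: a mod_mult_right_eq ac_simps)
  also have "s * u = 1 + r * (- t)" using st by (simp add: algebra_simps)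
  also have "v * (1 + r * (- t)) = v + r * (- t * v)" by (simp add: algebra_simps)
  also have "\<dots> mod r = v mod r" by (rule mod_mult_self2)
  finally have "g * ((u * int a) mod r) = g * (v mod r)" by simp
  then have "(c * int a) mod int m = d mod int m"
    unfolding eq by (simp only: mult_mod_right mult.assoc)
  moreover have "int m dvd c * int (nat r)" using r by (simp add: eq)
  ultimately show ?thesis using ca r by (intro exI[of _ a] exI[of _ "nat r"]) auto
qed

lemma exponential_sum_zero_same_gcd:
  assumes m: "m > 0" and gcd: "gcd (int m) c = gcd (int m) d"
    and zero: "(\<Sum>k\<in>K. unity_root m c ^ k) = 0"
  shows "(\<Sum>k\<in>K. unity_root m d ^ k) = 0"
proof -
  obtain a r where ar: "r > 0" "coprime a r" "int m dvd c * int r" "(c * int a) mod int m = d mod int m"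
    using same_gcd_imp_unit_multiple[OF m gcd] by blast
  have "unity_root m c ^ r = 1"
    using ar(3) m by (auto simp: unity_root_power unity_root_multiple elim!: dvdE)
  then have "(\<Sum>k\<in>K. (unity_root m c ^ a) ^ k) = 0"
    using ar(1,2) zero by (intro root_sum_zero_conjugate)
  moreover have "unity_root m c ^ a = unity_root m d"
    using unity_root_cong[OF m ar(4)] by (simp add: unity_root_power)
  ultimately show ?thesis by simp
qed

section \<open>Orthogonality of rows and the primitive set\<close>

definition rows_orthogonal :: "nat \<Rightarrow> nat set \<Rightarrow> nat set \<Rightarrow> bool" where
  "rows_orthogonal m J K \<longleftrightarrow>
     (\<forall>x\<in>J. \<forall>y\<in>J. x \<noteq> y \<longrightarrow> (\<Sum>k\<in>K. unity_root m (int x - int y) ^ k) = 0)"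

text \<open>Since \<open>m div gcd m d\<close> determines \<open>gcd m d\<close>, every difference in \<open>J'\<close> shares its gcd with a difference
in \<open>J\<close>. A nonzero \<open>d\<close> with \<open>\<bar>d\<bar> < m\<close> has \<open>gcd m d < m\<close>, so the matching difference in \<open>J\<close> is
nonzero as well, and orthogonality there transfers to \<open>d\<close>.\<close>
lemma rows_orthogonal_same_primitive_set:
  assumes m: "m > 0" and J': "J' \<subseteq> {0..<m}"
    and P: "primitive_set m J' \<subseteq> primitive_set m J"
    and orth: "rows_orthogonal m J K"
  shows "rows_orthogonal m J' K"
  unfolding rows_orthogonal_def
proof (intro ballI impI)
  fix x y assume xy: "x \<in> J'" "y \<in> J'" "x \<noteq> y"
  define d where "d = int x - int y"
  have "x < m" "y < m" using xy J' by auto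
  then have d: "d \<noteq> 0" "\<bar>d\<bar> < int m" using xy by (auto simp: d_def)
  have "int m div gcd (int m) d \<in> primitive_set m J'"
    using xy by (auto simp: primitive_set_def difference_set_def d_def)
  then obtain x0 y0 where xy0: "x0 \<in> J" "y0 \<in> J"
    and div: "int m div gcd (int m) (int x0 - int y0) = int m div gcd (int m) d"
    using P by (force simp: primitive_set_def difference_set_def)
  have gcd: "gcd (int m) (int x0 - int y0) = gcd (int m) d"
  proof -
    have "gcd (int m) e * (int m div gcd (int m) e) = int m" for e by simp
    from this[of d] this[of "int x0 - int y0"] div m show ?thesis
      by (metis mult_cancel_right mult_zero_right of_nat_0_eq_iff not_gr_zero)
  qed
  have "gcd (int m) d \<le> \<bar>d\<bar>" using d(1) by (simp add: zdvd_imp_le)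
  then have "x0 \<noteq> y0" using gcd d(2) by auto
  then have "(\<Sum>k\<in>K. unity_root m (int x0 - int y0) ^ k) = 0"
    using orth xy0 by (simp add: rows_orthogonal_def)
  then show "(\<Sum>k\<in>K. unity_root m (int x - int y) ^ k) = 0"
    using exponential_sum_zero_same_gcd[OF m gcd] by (simp add: d_def)
qed

section \<open>Hadamard submatrices and orthogonality\<close>

lemma bij_betw_pick: "finite S \<Longrightarrow> bij_betw (pick S) {..<card S} S"
proof (rule bij_betwI')
  fix x assume S: "finite S" 
  show "pick S x \<in> S" if "x \<in> {..<card S}" using that by (simp add: pick_in_set_le)
  fix y
  show "(pick S x = pick S y) = (x = y)" if "x \<in> {..<card S}" "y \<in> {..<card S}"
    using that by (metis card_pick_le lessThan_iff)
next
  fix y assume S: "finite S" "y \<in> S"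
  have "card {a\<in>S. a < y} < card S" using S by (intro psubset_card_mono) auto
  then show "\<exists>x\<in>{..<card S}. y = pick S x" using pick_card_in_set[OF S(2)] by force
qed

lemma mat_adjoint_carrier: "A \<in> carrier_mat n n \<Longrightarrow> mat_adjoint A \<in> carrier_mat n n"
  by (intro carrier_matI) (auto simp: mat_adjoint_def)

lemma mat_adjoint_index:
  assumes "A \<in> carrier_mat n n" "i < n" "j < n"
  shows "mat_adjoint A $$ (i, j) = conjugate (A $$ (j, i))"
  using assms by (simp add: mat_adjoint_def mat_of_rows_def)

context
  fixes m :: nat and J K :: "nat set" and n :: nat
  assumes m: "m > 0" and J: "J \<subseteq> {0..<m}" and K: "K \<subseteq> {0..<m}"
    and cJ: "card J = n" and cK: "card K = n"
begin

lemma fin: "finite J" "finite K"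
  using J K finite_subset by blast+

abbreviation (input) "H_JK \<equiv> submatrix (fourier_mat m) J K"

lemma submatrix_carrier: "H_JK \<in> carrier_mat n n"
proof -
  have "{i. i < m \<and> i \<in> J} = J" "{i. i < m \<and> i \<in> K} = K" using J K by auto
  then show ?thesis using cJ cK
    by (intro carrier_matI) (simp_all add: dim_submatrix fourier_mat_def)
qed

lemma fourier_submatrix_index:
  assumes "a < n" "b < n"
  shows "H_JK $$ (a, b) = unity_root m (int (pick J a) * int (pick K b))"
proof -
  have "{i. i < m \<and> i \<in> J} = J" "{i. i < m \<and> i \<in> K} = K" using J K by auto
  then have "H_JK $$ (a, b) = fourier_mat m $$ (pick J a, pick K b)"
    using assms cJ cK by (intro submatrix_index) (simp_all add: fourier_mat_def)
  moreover have "pick J a < m" "pick K b < m"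
    using J K assms cJ cK pick_in_set_le[of a J] pick_in_set_le[of b K] by auto
  ultimately show ?thesis
    by (simp add: fourier_mat_def unity_root_def cis_conv_exp ac_simps)
qed

lemma row_gram_index:
  assumes "a < n" "b < n"
  shows "(H_JK * mat_adjoint H_JK) $$ (a, b) = (\<Sum>k\<in>K. unity_root m (int (pick J a) - int (pick J b)) ^ k)"
proof -
  have c: "mat_adjoint H_JK \<in> carrier_mat n n" using submatrix_carrier by (rule mat_adjoint_carrier)
  have "(H_JK * mat_adjoint H_JK) $$ (a, b) = (\<Sum>i<n. H_JK $$ (a, i) * mat_adjoint H_JK $$ (i, b))"
    using submatrix_carrier c assms by (simp add: scalar_prod_def lessThan_atLeast0)
  also have "\<dots> = (\<Sum>i<n. unity_root m (int (pick J a) - int (pick J b)) ^ pick K i)"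
    by (intro sum.cong) (use assms in \<open>simp_all add: mat_adjoint_index[OF submatrix_carrier]
      fourier_submatrix_index unity_root_cnj unity_root_mult unity_root_power left_diff_distrib\<close>)
  also have "\<dots> = (\<Sum>k\<in>K. unity_root m (int (pick J a) - int (pick J b)) ^ k)"
    using sum.reindex_bij_betw[OF bij_betw_pick[OF fin(2)], unfolded cK] .
  finally show ?thesis .
qed

lemma column_gram_index:
  assumes "a < n" "b < n"
  shows "(mat_adjoint H_JK * H_JK) $$ (a, b) = (\<Sum>j\<in>J. unity_root m (int (pick K b) - int (pick K a)) ^ j)"
proof -
  have c: "mat_adjoint H_JK \<in> carrier_mat n n" using submatrix_carrier by (rule mat_adjoint_carrier)
  have "(mat_adjoint H_JK * H_JK) $$ (a, b) = (\<Sum>i<n. mat_adjoint H_JK $$ (a, i) * H_JK $$ (i, b))"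
    using submatrix_carrier c assms by (simp add: scalar_prod_def lessThan_atLeast0)
  also have "\<dots> = (\<Sum>i<n. unity_root m (int (pick K b) - int (pick K a)) ^ pick J i)"
    by (intro sum.cong) (use assms in \<open>simp_all add: mat_adjoint_index[OF submatrix_carrier]
      fourier_submatrix_index unity_root_cnj unity_root_mult unity_root_power left_diff_distrib right_diff_distrib mult.commute\<close>)
  also have "\<dots> = (\<Sum>j\<in>J. unity_root m (int (pick K b) - int (pick K a)) ^ j)"
    using sum.reindex_bij_betw[OF bij_betw_pick[OF fin(1)], unfolded cJ] .
  finally show ?thesis .
qed

text \<open>The second conclusion reads off the columns: \<open>H_JK\<close> has the rows of the submatrix with \<open>J\<close> and \<open>K\<close>
exchanged as its columns, because the Fourier matrix is symmetric.\<close>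
lemma hadamard_imp_rows_orthogonal:
  assumes "hadamard_mat H_JK"
  shows "rows_orthogonal m J K" "rows_orthogonal m K J"
proof -
  have dim: "dim_row H_JK = n" using submatrix_carrier by simp
  have HH: "H_JK * mat_adjoint H_JK = of_nat n \<cdot>\<^sub>m 1\<^sub>m n" "mat_adjoint H_JK * H_JK = of_nat n \<cdot>\<^sub>m 1\<^sub>m n"
    using assms unfolding hadamard_mat_def Let_def dim by blast+
  have J: "\<exists>a<n. x = pick J a" if "x \<in> J" for x
    using that bij_betw_pick[OF fin(1)] cJ by (force simp: bij_betw_def)
  have K: "\<exists>a<n. x = pick K a" if "x \<in> K" for x
    using that bij_betw_pick[OF fin(2)] cK by (force simp: bij_betw_def)
  show "rows_orthogonal m J K"
    unfolding rows_orthogonal_def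
  proof (intro ballI impI)
    fix x y assume xy: "x \<in> J" "y \<in> J" "x \<noteq> y"
    then obtain a b where ab: "a < n" "b < n" "x = pick J a" "y = pick J b" using J by metis
    then have "a \<noteq> b" using xy by auto
    then show "(\<Sum>k\<in>K. unity_root m (int x - int y) ^ k) = 0"
      using row_gram_index[OF ab(1,2)] ab HH by simp
  qed
  show "rows_orthogonal m K J"
    unfolding rows_orthogonal_def
  proof (intro ballI impI)
    fix x y assume xy: "x \<in> K" "y \<in> K" "x \<noteq> y"
    then obtain a b where ab: "a < n" "b < n" "x = pick K a" "y = pick K b" using K by metis
    then have "b \<noteq> a" using xy by auto
    then show "(\<Sum>k\<in>J. unity_root m (int x - int y) ^ k) = 0"
      using column_gram_index[OF ab(2,1)] ab HH by simp
  qed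
qed

text \<open>Orthogonal rows make the scaled adjoint a right inverse. For a square matrix it is then a left inverse,
which gives the orthogonality of the columns.\<close>
lemma rows_orthogonal_imp_hadamard:
  assumes "rows_orthogonal m J K" and n: "n > 0"
  shows "hadamard_mat H_JK"
proof -
  have dim: "dim_row H_JK = n" using submatrix_carrier by simp
  have c: "mat_adjoint H_JK \<in> carrier_mat n n" using submatrix_carrier by (rule mat_adjoint_carrier)
  have inj: "pick J a \<noteq> pick J b" if "a < n" "b < n" "a \<noteq> b" for a b
    using that bij_betw_pick[OF fin(1)] cJ by (auto simp: bij_betw_def inj_on_def)
  have inJ: "pick J a \<in> J" if "a < n" for a
    using that cJ pick_in_set_le by simp
  have HH: "H_JK * mat_adjoint H_JK = of_nat n \<cdot>\<^sub>m 1\<^sub>m n"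
  proof (rule eq_matI)
    fix a b assume "a < dim_row (of_nat n \<cdot>\<^sub>m 1\<^sub>m n :: complex mat)" 
      "b < dim_col (of_nat n \<cdot>\<^sub>m 1\<^sub>m n :: complex mat)"
    then have ab: "a < n" "b < n" by auto
    show "(H_JK * mat_adjoint H_JK) $$ (a, b) = (of_nat n \<cdot>\<^sub>m 1\<^sub>m n) $$ (a, b)"
    proof (cases "a = b")
      case True
      then show ?thesis using ab row_gram_index[OF ab] cK by (simp add: unity_root_def)
    next
      case False
      then have "(\<Sum>k\<in>K. unity_root m (int (pick J a) - int (pick J b)) ^ k) = 0"
        using assms(1) ab inj inJ by (simp add: rows_orthogonal_def)
      then show ?thesis using ab row_gram_index[OF ab] False by simp
    qed
  qed (use submatrix_carrier c in auto)
  let ?B = "(1 / of_nat n) \<cdot>\<^sub>m mat_adjoint H_JK"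
  have "H_JK * ?B = (1 / of_nat n) \<cdot>\<^sub>m (H_JK * mat_adjoint H_JK)"
    by (rule mult_smult_distrib[OF submatrix_carrier c])
  also have "\<dots> = 1\<^sub>m n" using n by (intro eq_matI) (auto simp: HH)
  finally have "?B * H_JK = 1\<^sub>m n"
    using mat_mult_left_right_inverse[OF submatrix_carrier, of ?B] c by simp
  then have "of_nat n \<cdot>\<^sub>m ((1 / of_nat n) \<cdot>\<^sub>m (mat_adjoint H_JK * H_JK)) = of_nat n \<cdot>\<^sub>m 1\<^sub>m n"
    using mult_smult_assoc_mat[OF c submatrix_carrier] by simp
  moreover have "of_nat n \<cdot>\<^sub>m ((1 / of_nat n) \<cdot>\<^sub>m (mat_adjoint H_JK * H_JK)) = mat_adjoint H_JK * H_JK"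
    using n by (intro eq_matI) auto
  ultimately have HH': "mat_adjoint H_JK * H_JK = of_nat n \<cdot>\<^sub>m 1\<^sub>m n" by simp
  show ?thesis
    unfolding hadamard_mat_def Let_def dim
    using submatrix_carrier HH HH' by (simp add: fourier_submatrix_index unity_root_def)
qed

end

section \<open>Invariance under equality of primitive sets\<close>

theorem theorem2p6:
  fixes m :: nat and J J' K K' :: "nat set"
  assumes "m \<ge> 1"
    and "J \<subseteq> {0..<m}" and "J' \<subseteq> {0..<m}" and "K \<subseteq> {0..<m}" and "K' \<subseteq> {0..<m}"
    and "J \<noteq> {}" and "J' \<noteq> {}" and "K \<noteq> {}" and "K' \<noteq> {}"
    and "card J = card J'" and "card J' = card K" and "card K = card K'"
    and "hadamard_mat (submatrix (fourier_mat m) J K)"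
  shows "(primitive_set m J' = primitive_set m J \<and> primitive_set m K' = primitive_set m K
            \<longrightarrow> hadamard_mat (submatrix (fourier_mat m) J' K')) \<and>
         (primitive_set m J' = primitive_set m K \<and> primitive_set m K' = primitive_set m J
            \<longrightarrow> hadamard_mat (submatrix (fourier_mat m) J' K'))"
proof -
  define n where "n = card J"
  have m: "m > 0" using assms(1) by simp
  have card: "card J = n" "card J' = n" "card K = n" "card K' = n"
    using assms(10-12) by (simp_all add: n_def)
  have n: "n > 0"
    using assms(2,6) finite_subset[of J "{0..<m}"] by (auto simp: n_def card_gt_0_iff)
  \<comment> \<open>Passing through the Hadamard property turns row orthogonality into column orthogonality.\<close>
  have transpose: "rows_orthogonal m Y X"
    if "rows_orthogonal m X Y" "X \<subseteq> {0..<m}" "Y \<subseteq> {0..<m}" "card X = n" "card Y = n" for X Y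
    using that hadamard_imp_rows_orthogonal(2)[OF m that(2-5)]
      rows_orthogonal_imp_hadamard[OF m that(2-5)] n by blast
  \<comment> \<open>The two cases of the theorem are \<open>(X, Y) = (J, K)\<close> and \<open>(X, Y) = (K, J)\<close>. The sets are
      replaced one at a time, with a transposition between the replacements.\<close>
  have main: "hadamard_mat (submatrix (fourier_mat m) J' K')"
    if "rows_orthogonal m X Y" "X \<subseteq> {0..<m}" "Y \<subseteq> {0..<m}" "card X = n" "card Y = n"
      "primitive_set m J' = primitive_set m X" "primitive_set m K' = primitive_set m Y" for X Y
  proof -
    have "rows_orthogonal m J' Y"
      using rows_orthogonal_same_primitive_set[OF m assms(3)] that by blast
    then have "rows_orthogonal m Y J'" using transpose assms(3) that card by blast
    then have "rows_orthogonal m K' J'"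
      using rows_orthogonal_same_primitive_set[OF m assms(5)] that by blast
    then have "rows_orthogonal m J' K'" using transpose assms(3,5) card by blast
    then show ?thesis
      using rows_orthogonal_imp_hadamard[OF m assms(3,5) card(2,4)] n by blast
  qed
  have "rows_orthogonal m J K" "rows_orthogonal m K J"
    using hadamard_imp_rows_orthogonal[OF m assms(2,4) card(1,3)] assms(13) by blast+
  then show ?thesis using main assms(2,4) card by blast
qed

end
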